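(* Let $\rho,\beta>0$ and let $\phi$ be a Ma-Minda function. Then there exists an $\alpha\in(0,1]$ such that $\{w:|w-1|<\alpha\}$ is the largest open disk centered at $1$ contained in $\phi(\mathbb D)$ and, whenever $\phi(-1)=1-\alpha$, $$R[\mathcal S^*(\phi)]=R[\mathcal S^*(1+\alpha z)]$$ for each of the normalized Wright functions $f_{\rho,\beta}$, $g_{\rho,\beta}$ and $h_{\rho,\beta}$.
   Context: Wright function: $\Phi(\rho,\beta,z)=\sum_{n\ge0}\frac{z^n}{n!\,\Gamma(n\rho+\beta)}$. Normalized Wright functions: $f_{\rho,\beta}(z)=[z^\beta\Gamma(\beta)\Phi(\rho,\beta,-z^2)]^{1/\beta}$, i.e. $z\,(\Gamma(\beta)\Phi(\rho,\beta,-z^2))^{1/\beta}$ with the branch of the power equal to $1$ at $z=0$; $g_{\rho,\beta}(z)=z\Gamma(\beta)\Phi(\rho,\beta,-z^2)$; $h_{\rho,\beta}(z)=z\Gamma(\beta)\Phi(\rho,\beta,-z)$. $\mathbb D$ is the open unit disk, $\mathcal A$ the analytic functions $f$ on $\mathbb D$ with $f(0)=0$, $f'(0)=1$. A Ma-Minda function is an analytic univalent $\phi$ on $\mathbb D$ with $\Re\phi>0$, $\phi(0)=1$, $\phi'(0)>0$, and $\phi(\mathbb D)$ starlike with respect to $1$ and symmetric about the real axis; $\phi(-1)$ means $\lim_{x\to-1^+}\phi(x)$. $\mathcal S^*(\phi)=\{f\in\mathcal A: zf'(z)/f(z)\prec\phi(z)\}$, where $\prec$ is subordination; since $\phi$ is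 univalent this means $zf'(z)/f(z)\in\phi(\mathbb D)$ on $\mathbb D$. The case $\phi(z)=1+\alpha z$ gives $\mathcal S^*(1+\alpha z)$. Radius: for a function $f$ analytic near $0$ with $f(0)=0$, $f'(0)=1$, the $\mathcal S^*(\phi)$-radius $R[\mathcal S^*(\phi)]$ of $f$ is the largest $r_0>0$ (not required to be $\le1$) such that $f$ belongs to the class in $|z|<r_0$: $f$ is analytic and zero-free except at $0$ there, and $zf'(z)/f(z)\in\phi(\mathbb D)$ for all $|z|<r_0$. *)

theory Defs
  imports "HOL-Complex_Analysis.Complex_Analysis"
begin

definition wright :: "real \<Rightarrow> real \<Rightarrow> complex \<Rightarrow> complex" where
  "wright \<rho> \<beta> z = (\<Sum>n. z ^ n / (fact n * of_real (Gamma (real n * \<rho> + \<beta>))))"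

(* The base of the power equals 1 at z = 0, so near 0 the principal power is the branch
   with value 1 there.  Away from 0 the principal power need not be the continuation of
   that branch; only the germ of wright_f at 0 is used (see in_starlike_class). *)
definition wright_f :: "real \<Rightarrow> real \<Rightarrow> complex \<Rightarrow> complex" where
  "wright_f \<rho> \<beta> z =
     z * (of_real (Gamma \<beta>) * wright \<rho> \<beta> (- (z ^ 2))) powr (of_real (1 / \<beta>))"

definition wright_g :: "real \<Rightarrow> real \<Rightarrow> complex \<Rightarrow> complex" where
  "wright_g \<rho> \<beta> z = z * of_real (Gamma \<beta>) * wright \<rho> \<beta> (- (z ^ 2))"

definition wright_h :: "real \<Rightarrow> real \<Rightarrow> complex \<Rightarrow> complex" where
  "wright_h \<rho> \<beta> z = z * of_real (Gamma \<beta>) * wright \<rho> \<beta> (- z)"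

definition ma_minda :: "(complex \<Rightarrow> complex) \<Rightarrow> bool" where
  "ma_minda \<phi> \<longleftrightarrow>
     \<phi> holomorphic_on ball 0 1 \<and> inj_on \<phi> (ball 0 1) \<and>
     (\<forall>z\<in>ball 0 1. Re (\<phi> z) > 0) \<and>
     \<phi> 0 = 1 \<and> deriv \<phi> 0 \<in> \<real> \<and> Re (deriv \<phi> 0) > 0 \<and>
     (\<forall>w\<in>\<phi> ` ball 0 1. closed_segment 1 w \<subseteq> \<phi> ` ball 0 1) \<and>
     cnj ` \<phi> ` ball 0 1 = \<phi> ` ball 0 1"

(* Membership of F in the class S*(phi) on the disk |z| < r.  At z = 0 the quotient
   z F'(z) / F(z) is read by continuity as 1 = phi 0, so nothing is required there. *)
definition starlike_on_disk :: "(complex \<Rightarrow> complex) \<Rightarrow> (complex \<Rightarrow> complex) \<Rightarrow> real \<Rightarrow> bool" where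
  "starlike_on_disk \<phi> F r \<longleftrightarrow>
     F holomorphic_on ball 0 r \<and> F 0 = 0 \<and> deriv F 0 = 1 \<and>
     (\<forall>z\<in>ball 0 r - {0}. F z \<noteq> 0 \<and> z * deriv F z / F z \<in> \<phi> ` ball 0 1)"

(* The same for a function f given near 0: f is replaced by its (unique) analytic
   continuation F to the disk, which has to exist. *)
definition in_starlike_class :: "(complex \<Rightarrow> complex) \<Rightarrow> (complex \<Rightarrow> complex) \<Rightarrow> real \<Rightarrow> bool" where
  "in_starlike_class \<phi> f r \<longleftrightarrow>
     (\<exists>F. (\<forall>\<^sub>F z in nhds 0. F z = f z) \<and> starlike_on_disk \<phi> F r)"

definition is_starlike_radius :: "(complex \<Rightarrow> complex) \<Rightarrow> (complex \<Rightarrow> complex) \<Rightarrow> real \<Rightarrow> bool" where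
  "is_starlike_radius \<phi> f r \<longleftrightarrow>
     r > 0 \<and> in_starlike_class \<phi> f r \<and> (\<forall>s>0. in_starlike_class \<phi> f s \<longrightarrow> s \<le> r)"

end

theory Submission
  imports Defs
begin

text \<open>
  Put \<open>L z = \<Gamma>(\<beta>) \<Phi>(\<rho>, \<beta>, -z)\<close>. Each of the three functions is \<open>z L(z\<^sup>j)\<^sup>\<kappa>\<close>, so its \<open>z
  F'/F\<close> is \<open>1 - \<kappa> j u Q(u)\<close> with \<open>u = z\<^sup>j\<close> and \<open>Q = -L'/L\<close>. The Taylor coefficients of \<open>Q\<close>
  are nonnegative (they are the power sums of the reciprocal zeros of \<open>L\<close>), hence \<open>|u
  Q(u)|\<close> is at most its value at \<open>|u|\<close>, and the positive \<open>u\<close> with \<open>\<kappa> j u Q(u) = \<alpha>\<close> gives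
  the radius for every target region that contains the disk of radius \<open>\<alpha>\<close> about \<open>1\<close> but
  omits \<open>1 - \<alpha>\<close>.

  Nonnegativity needs neither the Hadamard product nor the reality of the zeros of \<open>L\<close>:
  coefficientwise \<open>L\<close> is a limit of polynomials with positive zeros, and each coefficient
  of \<open>Q\<close> is a polynomial in the coefficients of \<open>L\<close>. The polynomials arise from \<open>(1 - a
  z)\<^sup>m\<close> by the operators \<open>p \<mapsto> c p + \<rho> z p'\<close>, which keep zeros positive and multiply the
  coefficients by the factors of the Gauss product for \<open>1/\<Gamma>(n \<rho> + \<beta>)\<close>.
\<close>

unbundle no vec_syntax

subsection \<open>Polynomials with positive zeros\<close>

text \<open>Nonvanishing at 0 turns nonnegative zeros into positive ones and rules out the zero
  polynomial.\<close>

definition positive_roots :: "complex poly \<Rightarrow> bool" where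
  "positive_roots p \<longleftrightarrow> poly p 0 \<noteq> 0 \<and> (\<forall>z. poly p z = 0 \<longrightarrow> z \<in> \<real>\<^sub>\<ge>\<^sub>0)"

text \<open>The fundamental theorem of algebra splits off one factor at a time. Sums over zeros thus
  become inductions, with no list of zeros to handle.\<close>

lemma positive_roots_induct [consumes 1, case_names const linear]:
  assumes "positive_roots p"
    and "\<And>c. c \<noteq> 0 \<Longrightarrow> P [:c:]"
    and "\<And>l q. l > 0 \<Longrightarrow> positive_roots q \<Longrightarrow> P q \<Longrightarrow> P ([:- complex_of_real l, 1:] * q)"
  shows "P p"
  using assms(1)
proof (induction "degree p" arbitrary: p rule: less_induct)
  case less
  show ?case
  proof (cases "degree p = 0")
    case True
    then obtain c where "p = [:c:]" by (rule degree_eq_zeroE)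
    with less.prems assms(2) show ?thesis by (auto simp: positive_roots_def)
  next
    case False
    then have "\<exists>i\<in>{1..degree p}. coeff p i \<noteq> 0"
      by (intro bexI[of _ "degree p"]) auto
    then obtain z where "(\<Sum>i\<le>degree p. coeff p i * z ^ i) = 0"
      by (rule fundamental_theorem_of_algebra[OF disjI2])
    then have z: "poly p z = 0" by (simp add: poly_altdef)
    with less.prems have "z \<in> \<real>\<^sub>\<ge>\<^sub>0" "z \<noteq> 0" by (auto simp: positive_roots_def)
    then obtain l where l: "z = of_real l" "l > 0"
      by (auto elim!: nonneg_Reals_cases simp: less_le)
    from z obtain q where p: "p = [:- of_real l, 1:] * q"
      unfolding poly_eq_0_iff_dvd l dvd_def by blast
    have q: "positive_roots q" using less.prems by (auto simp: positive_roots_def p)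
    then have "q \<noteq> 0" by (auto simp: positive_roots_def)
    then have "degree q < degree p" unfolding p by (subst degree_mult_eq) auto
    then show ?thesis using assms(3)[OF l(2) q] less.hyps q p by blast
  qed
qed

lemma positive_roots_smult: "c \<noteq> 0 \<Longrightarrow> positive_roots p \<Longrightarrow> positive_roots (smult c p)"
  by (simp add: positive_roots_def)

lemma positive_roots_linear_power:
  assumes "a > 0"
  shows "positive_roots ([:1, - complex_of_real a:] ^ m)"
  unfolding positive_roots_def
proof (intro conjI allI impI)
  fix z assume "poly ([:1, - complex_of_real a:] ^ m) z = 0"
  then have "1 = z * of_real a" by (auto simp: poly_power)
  then have "z = of_real (1 / a)" using assms by (auto simp: field_simps)
  then show "z \<in> \<real>\<^sub>\<ge>\<^sub>0" using assms by (simp only: nonneg_Reals_of_real_iff) simp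
qed (simp add: poly_power)

text \<open>\<open>z p'/p\<close> is a sum of terms \<open>z/(z - l)\<close> with \<open>l > 0\<close>, whose imaginary parts all have the sign of \<open>-Im z\<close>.\<close>
lemma dlog_linear_times:
  fixes z :: complex
  assumes "poly q z \<noteq> 0" "z - l \<noteq> 0"
  shows "z * poly (pderiv ([:- l, 1:] * q)) z / poly ([:- l, 1:] * q) z
      = z / (z - l) + z * poly (pderiv q) z / poly q z"
proof -
  have "pderiv ([:- l, 1:] * q) = [:- l, 1:] * pderiv q + q"
    unfolding pderiv_mult by (simp add: pderiv_pCons)
  then have "poly (pderiv ([:- l, 1:] * q)) z = (z - l) * poly (pderiv q) z + poly q z"
    by (simp only:) (simp add: algebra_simps)
  moreover have "poly ([:- l, 1:] * q) z = (z - l) * poly q z"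
    by (simp add: algebra_simps)
  ultimately have "z * poly (pderiv ([:- l, 1:] * q)) z / poly ([:- l, 1:] * q) z
      = z * ((z - l) * poly (pderiv q) z + poly q z) / ((z - l) * poly q z)" by (simp only:)
  also have "\<dots> = z / (z - l) + z * poly (pderiv q) z / poly q z"
  proof -
    have "z * (w * y + x) / (w * x) = z / w + z * y / x" if "w \<noteq> 0" "x \<noteq> 0" for w x y
      using that by (simp add: field_simps)
    then show ?thesis using assms by blast
  qed
  finally show ?thesis .
qed

text \<open>The first alternative is there for constants: without zeros the sum is empty and has no
  sign.\<close>

lemma positive_roots_dlog_nonreal:
  assumes "positive_roots p" "Im z \<noteq> 0"
  shows "poly (pderiv p) z = 0 \<or> Im (z * poly (pderiv p) z / poly p z) * Im z < 0"
  using assms(1)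
proof (induction rule: positive_roots_induct)
  case (const c)
  then show ?case by (simp add: pderiv_pCons)
next
  case (linear l q)
  have q0: "poly q z \<noteq> 0"
    using linear(2) assms(2) by (auto simp: positive_roots_def complex_nonneg_Reals_iff)
  have zl: "z - of_real l \<noteq> 0" using assms(2) by (auto simp: complex_eq_iff)
  have split: "z * poly (pderiv ([:- of_real l, 1:] * q)) z / poly ([:- of_real l, 1:] * q) z
      = z / (z - of_real l) + z * poly (pderiv q) z / poly q z"
    by (rule dlog_linear_times[OF q0 zl])
  have "Im (z / (z - of_real l)) = - l * Im z / ((Re z - l)\<^sup>2 + (Im z)\<^sup>2)"
    by (simp add: Im_divide algebra_simps)
  moreover have "(Re z - l)\<^sup>2 + (Im z)\<^sup>2 > 0" using assms(2) by (simp add: sum_power2_gt_zero_iff)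
  ultimately have neg: "Im (z / (z - of_real l)) * Im z < 0"
    using linear(1) assms(2) by (simp add: mult.assoc flip: power2_eq_square)
  from linear(3) show ?case
  proof
    assume "poly (pderiv q) z = 0"
    then show ?thesis unfolding split using neg by simp
  next
    assume "Im (z * poly (pderiv q) z / poly q z) * Im z < 0"
    then show ?thesis unfolding split plus_complex.sel distrib_right using neg by linarith
  qed
qed

text \<open>Each term \<open>x / (x - l)\<close> has a nonpositive numerator and a negative
  denominator.\<close>

lemma positive_roots_dlog_nonpos:
  assumes "positive_roots p" "x \<le> 0"
  shows "Re (of_real x * poly (pderiv p) (of_real x) / poly p (of_real x)) \<ge> 0"
  using assms(1)
proof (induction rule: positive_roots_induct)
  case (const c)
  then show ?case by (simp add: pderiv_pCons)
next
  case (linear l q)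
  let ?z = "complex_of_real x"
  have q0: "poly q ?z \<noteq> 0"
  proof
    assume *: "poly q ?z = 0"
    with linear(2) have "?z \<in> \<real>\<^sub>\<ge>\<^sub>0" by (auto simp: positive_roots_def)
    then have "x = 0" using assms(2) by simp
    with * linear(2) show False by (simp add: positive_roots_def)
  qed
  have zl: "?z - of_real l \<noteq> 0" using assms(2) linear(1) by (auto simp: complex_eq_iff)
  have split: "?z * poly (pderiv ([:- of_real l, 1:] * q)) ?z / poly ([:- of_real l, 1:] * q) ?z
      = ?z / (?z - of_real l) + ?z * poly (pderiv q) ?z / poly q ?z"
    by (rule dlog_linear_times[OF q0 zl])
  have "?z / (?z - of_real l) = of_real (x / (x - l))" by simp
  then have "Re (?z / (?z - of_real l)) = x / (x - l)" by (simp only: Re_complex_of_real)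
  moreover have "x / (x - l) \<ge> 0" using assms(2) linear(1) by (simp add: zero_le_divide_iff)
  ultimately show ?case using linear(3) unfolding split by simp
qed

text \<open>At a zero of the new polynomial \<open>z p'/p\<close> would be negative.\<close>
lemma positive_roots_euler:
  assumes p: "positive_roots p" and "\<rho> > 0" "c > 0"
  shows "positive_roots (smult (of_real c) p + smult (of_real \<rho>) (pCons 0 (pderiv p)))"
  unfolding positive_roots_def
proof (intro conjI allI impI)
  show "poly (smult (of_real c) p + smult (of_real \<rho>) (pCons 0 (pderiv p))) 0 \<noteq> 0"
    using assms by (simp add: positive_roots_def)
next
  fix z
  assume "poly (smult (of_real c) p + smult (of_real \<rho>) (pCons 0 (pderiv p))) z = 0"
  then have eq: "of_real c * poly p z + of_real \<rho> * (z * poly (pderiv p) z) = 0"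
    by (simp add: mult.commute mult.left_commute)
  show "z \<in> \<real>\<^sub>\<ge>\<^sub>0"
  proof (cases "poly p z = 0")
    case True
    with p show ?thesis by (simp add: positive_roots_def)
  next
    case False
    have "w / x = of_real (- c / \<rho>)" if "of_real c * x + of_real \<rho> * w = 0" "x \<noteq> 0" for w x :: complex
      using that assms(2) by (simp add: field_simps eq_neg_iff_add_eq_0)
    from this[OF eq False] have s: "z * poly (pderiv p) z / poly p z = of_real (- c / \<rho>)" .
    \<comment> \<open>A vanishing derivative would make the quotient 0 instead of
      \<open>- c / \<rho>\<close>. So a nonreal \<open>z\<close> would give the real quotient a
      nonzero imaginary part.\<close>
    have "poly (pderiv p) z \<noteq> 0" using s assms by auto
    then have "Im z = 0"
      using positive_roots_dlog_nonreal[OF p, of z] unfolding s by auto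
    moreover have "\<not> Re z \<le> 0"
    proof
      assume "Re z \<le> 0"
      with positive_roots_dlog_nonpos[OF p this] \<open>Im z = 0\<close> s
      have "- c / \<rho> \<ge> 0" by (simp add: complex_is_Real_iff complex_eq_iff del: of_real_minus of_real_divide)
      then show False using divide_pos_pos[OF assms(3,2)] by simp
    qed
    ultimately show ?thesis by (simp add: complex_nonneg_Reals_iff)
  qed
qed

text \<open>The operator with \<open>c = \<beta> + k\<close> multiplies the \<open>n\<close>-th
  coefficient by \<open>n * \<rho> + \<beta> + k\<close>, the next factor of the Pochhammer
  symbol.\<close>

lemma positive_roots_pochhammer:
  assumes "positive_roots p" "\<rho> > 0" "\<beta> > 0"
  shows "\<exists>q. positive_roots q \<and>
    (\<forall>n. coeff q n = coeff p n * of_real (pochhammer (real n * \<rho> + \<beta>) k))"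
proof (induction k)
  case 0
  show ?case using assms by auto
next
  case (Suc k)
  then obtain q where q: "positive_roots q"
    "\<And>n. coeff q n = coeff p n * of_real (pochhammer (real n * \<rho> + \<beta>) k)" by blast
  have "positive_roots (smult (of_real (\<beta> + real k)) q + smult (of_real \<rho>) (pCons 0 (pderiv q)))"
    using assms by (intro positive_roots_euler q) auto
  moreover have "coeff (smult (of_real (\<beta> + real k)) q + smult (of_real \<rho>) (pCons 0 (pderiv q))) n
      = coeff p n * of_real (pochhammer (real n * \<rho> + \<beta>) (Suc k))" for n
    by (cases n) (auto simp: q(2) coeff_pCons coeff_pderiv pochhammer_Suc algebra_simps)
  ultimately show ?case by blast
qed

subsection \<open>Logarithmic derivatives of formal power series\<close>

definition neg_dlog :: "complex fps \<Rightarrow> complex fps" where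
  "neg_dlog F = - fps_deriv F / F"

lemma neg_dlog_times: "F $ 0 \<noteq> 0 \<Longrightarrow> neg_dlog F * F = - fps_deriv F"
  by (simp add: neg_dlog_def fps_divide_unit inverse_mult_eq_1 mult.assoc)

lemma neg_dlog_unique: "F $ 0 \<noteq> 0 \<Longrightarrow> Q * F = - fps_deriv F \<Longrightarrow> neg_dlog F = Q"
  by (metis neg_dlog_times fps_nonzero_nth mult_right_cancel)

text \<open>This is the geometric series of \<open>1 / (l - z)\<close>.\<close>

lemma neg_dlog_linear:
  assumes "l \<noteq> 0"
  shows "neg_dlog (fps_of_poly [:- l, 1:]) = Abs_fps (\<lambda>k. 1 / l ^ Suc k)"
proof (rule neg_dlog_unique)
  have "fps_of_poly [:- l, 1:] = fps_X - fps_const l"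
    by (simp add: fps_of_poly_pCons)
  then show "Abs_fps (\<lambda>k. 1 / l ^ Suc k) * fps_of_poly [:- l, 1:] = - fps_deriv (fps_of_poly [:- l, 1:])"
    using assms by (simp only:) (auto simp: fps_eq_iff right_diff_distrib gr0_conv_Suc)
qed (use assms in simp)

text \<open>Logarithmic derivatives turn products into sums, and a zero \<open>l > 0\<close>
  contributes \<open>1 / l ^ Suc k\<close>.\<close>

lemma neg_dlog_nonneg_of_positive_roots:
  assumes "positive_roots p"
  shows "neg_dlog (fps_of_poly p) $ k \<in> \<real>\<^sub>\<ge>\<^sub>0"
  using assms
proof (induction rule: positive_roots_induct)
  case (const c)
  have "neg_dlog (fps_of_poly [:c:]) = 0" by (simp add: neg_dlog_def fps_of_poly_const)
  then show ?case by simp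
next
  case (linear l q)
  let ?f = "fps_of_poly [:- complex_of_real l, 1:]" and ?g = "fps_of_poly q"
  have nz: "?f $ 0 \<noteq> 0" "?g $ 0 \<noteq> 0"
    using linear(1,2) by (auto simp: positive_roots_def poly_0_coeff_0)
  have "neg_dlog (?f * ?g) = neg_dlog ?f + neg_dlog ?g"
  proof (rule neg_dlog_unique)
    have "(neg_dlog ?f + neg_dlog ?g) * (?f * ?g)
      = (neg_dlog ?f * ?f) * ?g + ?f * (neg_dlog ?g * ?g)" by (simp only: algebra_simps)
    also have "\<dots> = - fps_deriv (?f * ?g)"
      unfolding neg_dlog_times[OF nz(1)] neg_dlog_times[OF nz(2)] by (simp add: algebra_simps)
    finally show "(neg_dlog ?f + neg_dlog ?g) * (?f * ?g) = - fps_deriv (?f * ?g)" .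
  qed (use nz in simp)
  moreover have "neg_dlog ?f $ k \<in> \<real>\<^sub>\<ge>\<^sub>0"
  proof -
    have "neg_dlog ?f $ k = of_real (1 / l ^ Suc k)"
      using linear(1) by (subst neg_dlog_linear) auto
    then show ?thesis using linear(1) by (simp only: nonneg_Reals_of_real_iff) simp
  qed
  ultimately show ?case using linear(3) unfolding fps_of_poly_mult by simp
qed

text \<open>Comparing coefficients in \<open>neg_dlog F * F = - fps_deriv F\<close> gives a
  recursion that involves only finitely many coefficients of \<open>F\<close>. Coefficientwise
  limits therefore pass through it.\<close>

lemma neg_dlog_nth:
  assumes "F $ 0 \<noteq> 0"
  shows "neg_dlog F $ k =
    (- (of_nat (Suc k) * F $ Suc k) - (\<Sum>i<k. neg_dlog F $ i * F $ (k - i))) / F $ 0"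
proof -
  have "(neg_dlog F * F) $ k = - (of_nat (Suc k) * F $ Suc k)"
    using neg_dlog_times[OF assms] by simp
  moreover have "(neg_dlog F * F) $ k
      = (\<Sum>i<k. neg_dlog F $ i * F $ (k - i)) + neg_dlog F $ k * F $ 0"
    by (simp add: fps_mult_nth atLeast0AtMost flip: lessThan_Suc_atMost)
  ultimately show ?thesis using assms by (simp add: field_simps)
qed

lemma tendsto_neg_dlog_nth:
  assumes "\<And>n. (\<lambda>m. F m $ n) \<longlonglongrightarrow> G $ n"
    and "\<And>m. F m $ 0 \<noteq> 0" "G $ 0 \<noteq> 0"
  shows "(\<lambda>m. neg_dlog (F m) $ k) \<longlonglongrightarrow> neg_dlog G $ k"
proof (induction k rule: less_induct)
  case (less k)
  have "(\<lambda>m. (- (of_nat (Suc k) * F m $ Suc k) - (\<Sum>i<k. neg_dlog (F m) $ i * F m $ (k - i))) / F m $ 0)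
    \<longlonglongrightarrow> (- (of_nat (Suc k) * G $ Suc k) - (\<Sum>i<k. neg_dlog G $ i * G $ (k - i))) / G $ 0"
    by (intro tendsto_intros assms less.IH) auto
  then show ?case
    unfolding neg_dlog_nth[OF assms(2), symmetric] neg_dlog_nth[OF assms(3), symmetric] .
qed

subsection \<open>The power series of the Wright function\<close>

lemma choose_over_power_tendsto:
  "(\<lambda>m. real (m choose n) / real m ^ n) \<longlonglongrightarrow> 1 / fact n"
proof (induction n)
  case (Suc n)
  have "(\<lambda>m. real (m choose n) / real m ^ n * ((1 - real n / real m) / real (Suc n)))
      \<longlonglongrightarrow> 1 / fact n * ((1 - 0) / real (Suc n))"
    by (intro tendsto_intros Suc lim_const_over_n) auto
  moreover have "eventually (\<lambda>m. real (m choose n) / real m ^ n * ((1 - real n / real m) / real (Suc n))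
      = real (m choose Suc n) / real m ^ Suc n) sequentially"
    using eventually_gt_at_top[of "max n 0"]
  proof eventually_elim
    case (elim m)
    have "Suc n * (m choose Suc n) = (m - n) * (m choose n)"
      by (simp only: binomial_absorption binomial_absorb_comp)
    then have "real (Suc n) * real (m choose Suc n) = (real m - real n) * real (m choose n)"
      using elim by (metis of_nat_mult of_nat_diff less_imp_le max_less_iff_conj)
    then have "real (m choose Suc n) = (real m - real n) * real (m choose n) / real (Suc n)"
      by (simp add: field_simps)
    moreover have "(1 - real n / real m) = (real m - real n) / real m"
      using elim by (simp add: diff_divide_distrib)
    ultimately show ?case by (simp add: mult_ac)
  qed
  ultimately have "(\<lambda>m. real (m choose Suc n) / real m ^ Suc n)
      \<longlonglongrightarrow> 1 / fact n * ((1 - 0) / real (Suc n))"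
    by (rule Lim_transform_eventually)
  then show ?case by (simp add: field_simps)
qed simp

definition wright_fps :: "real \<Rightarrow> real \<Rightarrow> complex fps" where
  "wright_fps \<rho> \<beta> = Abs_fps (\<lambda>n. of_real ((-1) ^ n / fact n * (Gamma \<beta> / Gamma (real n * \<rho> + \<beta>))))"

lemma wright_fps_nth_0: "\<beta> > 0 \<Longrightarrow> wright_fps \<rho> \<beta> $ 0 = 1"
  by (simp add: wright_fps_def Gamma_real_pos less_imp_neq[symmetric])

text \<open>The Gauss product has \<open>rGamma_series x m = pochhammer x (m + 1) / (fact m * m powr
  x)\<close> for \<open>m > 0\<close>. In the quotient of two such terms the factorials cancel and
  \<open>m powr (- n * \<rho>)\<close> remains, which is why \<open>m powr (- \<rho>)\<close> is
  built into the zero of the polynomial.\<close>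

lemma wright_coeff_limit:
  assumes "\<rho> > 0" "\<beta> > 0"
  shows "(\<lambda>m. real (m choose n) * (- (1 / real m * real m powr (- \<rho>))) ^ n *
      (pochhammer (real n * \<rho> + \<beta>) (m + 1) / pochhammer \<beta> (m + 1)))
    \<longlonglongrightarrow> (-1) ^ n / fact n * (Gamma \<beta> / Gamma (real n * \<rho> + \<beta>))"
proof -
  have "real n * \<rho> + \<beta> > 0" using assms by (simp add: add_nonneg_pos)
  then have nz: "rGamma \<beta> \<noteq> 0" 
    using assms by (simp add: rGamma_inverse_Gamma less_imp_neq[OF Gamma_real_pos, symmetric])
  have "(\<lambda>m. (-1) ^ n * (real (m choose n) / real m ^ n) *
      (rGamma_series (real n * \<rho> + \<beta>) m / rGamma_series \<beta> m))
    \<longlonglongrightarrow> (-1) ^ n * (1 / fact n) * (rGamma (real n * \<rho> + \<beta>) / rGamma \<beta>)"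
    by (intro tendsto_intros choose_over_power_tendsto nz)
  also have "(-1) ^ n * (1 / fact n) * (rGamma (real n * \<rho> + \<beta>) / rGamma \<beta>)
      = (-1) ^ n / fact n * (Gamma \<beta> / Gamma (real n * \<rho> + \<beta>))"
    by (simp add: rGamma_inverse_Gamma field_simps)
  finally have lim: "(\<lambda>m. (-1) ^ n * (real (m choose n) / real m ^ n) *
      (rGamma_series (real n * \<rho> + \<beta>) m / rGamma_series \<beta> m))
    \<longlonglongrightarrow> (-1) ^ n / fact n * (Gamma \<beta> / Gamma (real n * \<rho> + \<beta>))" .
  show ?thesis
  proof (rule Lim_transform_eventually[OF lim])
    show "eventually (\<lambda>m. (-1) ^ n * (real (m choose n) / real m ^ n) *
      (rGamma_series (real n * \<rho> + \<beta>) m / rGamma_series \<beta> m) = 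
      real (m choose n) * (- (1 / real m * real m powr (- \<rho>))) ^ n *
      (pochhammer (real n * \<rho> + \<beta>) (m + 1) / pochhammer \<beta> (m + 1))) sequentially"
      using eventually_gt_at_top[of 0]
    proof eventually_elim
      case (elim m)
      have e: "exp ((real n * \<rho> + \<beta>) * ln (real m)) = exp (\<beta> * ln (real m)) / (real m powr (- \<rho>)) ^ n"
        using elim by (simp add: powr_def distrib_right exp_add exp_minus field_simps
            flip: exp_of_nat_mult)
      have p: "(- (1 / real m * real m powr (- \<rho>))) ^ n = (-1) ^ n / real m ^ n * (real m powr (- \<rho>)) ^ n"
        by (subst power_minus) (simp add: power_mult_distrib power_divide)
      show ?case unfolding rGamma_series_def of_real_eq_id id_apply e p by simp
    qed
  qed
qed

text \<open>The polynomials realize the coefficients of \<open>wright_coeff_limit\<close>, and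
  nonnegativity survives the limit because the nonnegative reals are closed.\<close>

lemma neg_dlog_wright_nonneg:
  assumes "\<rho> > 0" "\<beta> > 0"
  shows "neg_dlog (wright_fps \<rho> \<beta>) $ k \<in> \<real>\<^sub>\<ge>\<^sub>0"
proof -
  \<comment> \<open>The index \<open>Suc m\<close> avoids \<open>m = 0\<close>, where
    \<open>1 / real m\<close> is 0 and the parameter \<open>a\<close> would not be positive.\<close>
  have "\<exists>q. positive_roots q \<and> (\<forall>n. coeff q n = of_real (real (Suc m choose n) *
      (- (1 / real (Suc m) * real (Suc m) powr (- \<rho>))) ^ n *
      (pochhammer (real n * \<rho> + \<beta>) (Suc m + 1) / pochhammer \<beta> (Suc m + 1))))" for m
  proof -
    define a where "a = 1 / real (Suc m) * real (Suc m) powr (- \<rho>)"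
    have "a > 0" by (simp add: a_def)
    from positive_roots_pochhammer[OF positive_roots_linear_power[OF this] assms]
    obtain q where q: "positive_roots q"
      "\<And>n. coeff q n = coeff ([:1, - complex_of_real a:] ^ Suc m) n *
        of_real (pochhammer (real n * \<rho> + \<beta>) (Suc m + 1))" by blast
    have c: "coeff ([:1, - complex_of_real a:] ^ Suc m) n = of_nat (Suc m choose n) * (- of_real a) ^ n" for n
    proof (cases "n \<le> Suc m")
      case False
      moreover have "degree ([:1, - complex_of_real a:] ^ Suc m) \<le> Suc m"
        using degree_power_le[of "[:1, - complex_of_real a:]" "Suc m"] \<open>a > 0\<close>
        by (simp del: power_Suc)
      ultimately show ?thesis by (simp add: coeff_eq_0 binomial_eq_0 del: power_Suc binomial_Suc_Suc)
    qed (simp add: coeff_linear_poly_power del: power_Suc binomial_Suc_Suc)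
    have nz: "pochhammer \<beta> (Suc m + 1) \<noteq> 0"
      using assms(2) pochhammer_pos[of \<beta> "Suc m + 1"] by linarith
    have "positive_roots (smult (of_real (1 / pochhammer \<beta> (Suc m + 1))) q)"
      using nz by (intro positive_roots_smult q) (simp only: of_real_eq_0_iff, simp)
    moreover have "coeff (smult (of_real (1 / pochhammer \<beta> (Suc m + 1))) q) n
        = of_real (real (Suc m choose n) * (- a) ^ n *
          (pochhammer (real n * \<rho> + \<beta>) (Suc m + 1) / pochhammer \<beta> (Suc m + 1)))" for n
      using nz by (simp add: q(2) c del: power_Suc binomial_Suc_Suc)
    ultimately show ?thesis unfolding a_def by blast
  qed
  then obtain q where q: "\<And>m. positive_roots (q m)"
    "\<And>m n. coeff (q m) n = of_real (real (Suc m choose n) *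
      (- (1 / real (Suc m) * real (Suc m) powr (- \<rho>))) ^ n *
      (pochhammer (real n * \<rho> + \<beta>) (Suc m + 1) / pochhammer \<beta> (Suc m + 1)))"
    by metis
  have "(\<lambda>m. neg_dlog (fps_of_poly (q m)) $ k) \<longlonglongrightarrow> neg_dlog (wright_fps \<rho> \<beta>) $ k"
  proof (rule tendsto_neg_dlog_nth)
    show "(\<lambda>m. fps_of_poly (q m) $ n) \<longlonglongrightarrow> wright_fps \<rho> \<beta> $ n" for n
      unfolding fps_of_poly_nth q(2) wright_fps_def fps_nth_Abs_fps
      by (intro tendsto_of_real filterlim_compose[OF wright_coeff_limit filterlim_Suc] assms)
    show "fps_of_poly (q m) $ 0 \<noteq> 0" for m
      using q(1)[of m] by (simp add: positive_roots_def poly_0_coeff_0)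
    show "wright_fps \<rho> \<beta> $ 0 \<noteq> 0" using assms by (simp add: wright_fps_nth_0)
  qed
  moreover have "eventually (\<lambda>m. neg_dlog (fps_of_poly (q m)) $ k \<in> \<real>\<^sub>\<ge>\<^sub>0) sequentially"
    by (intro always_eventually allI neg_dlog_nonneg_of_positive_roots q)
  ultimately show ?thesis
    by (intro Lim_in_closed_set[OF closed_nonneg_Reals_complex]) auto
qed

section \<open>Convergence of the Wright series\<close>

lemma Gamma_lower_bound:
  fixes \<beta> :: real
  assumes "\<beta> > 0"
  shows "\<exists>m>0. \<forall>x\<ge>\<beta>. m \<le> Gamma x"
proof -
  \<comment> \<open>The minimum with 1 ensures that \<open>x - 1\<close> stays above the left end
    for every \<open>x > 2\<close>. The bound then climbs in unit steps by
    \<open>Gamma x = (x - 1) * Gamma (x - 1)\<close>.\<close>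
  let ?K = "{min \<beta> 1..2::real}"
  have "continuous_on ?K Gamma"
    using assms by (intro continuous_intros) (auto elim!: nonpos_Ints_cases)
  then obtain a where a: "a \<in> ?K" "\<And>x. x \<in> ?K \<Longrightarrow> Gamma a \<le> Gamma x"
    using continuous_attains_inf[of ?K Gamma] by fastforce
  have step: "\<forall>x. min \<beta> 1 \<le> x \<and> x \<le> 2 + real n \<longrightarrow> Gamma a \<le> Gamma x" for n
  proof (induction n)
    case 0
    then show ?case using a(2) by auto
  next
    case (Suc n)
    show ?case
    proof (intro allI impI)
      fix x assume x: "min \<beta> 1 \<le> x \<and> x \<le> 2 + real (Suc n)"
      show "Gamma a \<le> Gamma x"
      proof (cases "x \<le> 2")
        case True
        then show ?thesis using x a(2)[of x] by simp
      next
        case False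
        then have "Gamma a \<le> Gamma (x - 1)" using Suc x by auto
        also have "\<dots> \<le> (x - 1) * Gamma (x - 1)"
          using False Gamma_real_pos[of "x - 1"] by simp
        also have "\<dots> = Gamma x"
        proof -
          have "x - 1 \<notin> \<int>\<^sub>\<le>\<^sub>0" using False nonpos_Ints_nonpos[of "x - 1"] by auto
          from Gamma_plus1[OF this] show ?thesis by simp
        qed
        finally show ?thesis .
      qed
    qed
  qed
  have "Gamma a \<le> Gamma x" if "x \<ge> \<beta>" for x
    using step[of "nat \<lceil>x\<rceil>"] that real_nat_ceiling_ge[of x] by auto
  moreover have "Gamma a > 0" using a(1) assms by (intro Gamma_real_pos) auto
  ultimately show ?thesis by blast
qed

text \<open>A positive lower bound for \<open>Gamma\<close> makes the exponential series a
  majorant.\<close>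

lemma wright_fps_conv_radius:
  assumes "\<rho> > 0" "\<beta> > 0"
  shows "fps_conv_radius (wright_fps \<rho> \<beta>) = \<infinity>"
  unfolding fps_conv_radius_def
proof (rule conv_radius_inftyI'')
  fix z :: complex
  obtain m where m: "m > 0" "\<And>x. x \<ge> \<beta> \<Longrightarrow> m \<le> Gamma x"
    using Gamma_lower_bound[OF assms(2)] by blast
  have "summable (\<lambda>n. Gamma \<beta> / m * (norm z ^ n /\<^sub>R fact n))"
    by (intro summable_mult summable_exp_generic)
  then show "summable (\<lambda>n. wright_fps \<rho> \<beta> $ n * z ^ n)"
  proof (rule summable_comparison_test'[where N = 0])
    fix n
    have G: "Gamma (real n * \<rho> + \<beta>) > 0" "Gamma \<beta> > 0" "m \<le> Gamma (real n * \<rho> + \<beta>)"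
      using assms by (auto intro!: Gamma_real_pos m add_nonneg_pos)
    have "norm (wright_fps \<rho> \<beta> $ n * z ^ n)
        = norm z ^ n / fact n * (Gamma \<beta> / Gamma (real n * \<rho> + \<beta>))"
      using G by (simp add: wright_fps_def norm_mult norm_power norm_divide)
    also have "\<dots> \<le> norm z ^ n / fact n * (Gamma \<beta> / m)"
      using G m(1) by (intro mult_left_mono divide_left_mono) auto
    finally show "norm (wright_fps \<rho> \<beta> $ n * z ^ n) \<le> Gamma \<beta> / m * (norm z ^ n /\<^sub>R fact n)"
      by (simp add: field_simps)
  qed
qed

lemma eval_wright_fps:
  assumes "\<rho> > 0" "\<beta> > 0"
  shows "eval_fps (wright_fps \<rho> \<beta>) z = of_real (Gamma \<beta>) * wright \<rho> \<beta> (- z)"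
proof -
  have nz: "complex_of_real (Gamma \<beta>) \<noteq> 0" using Gamma_real_pos[OF assms(2)] by simp
  have eq: "(- z) ^ n / (fact n * of_real (Gamma (real n * \<rho> + \<beta>)))
      = wright_fps \<rho> \<beta> $ n * z ^ n / of_real (Gamma \<beta>)" for n
    using nz by (subst power_minus) (simp add: wright_fps_def)
  have "summable (\<lambda>n. wright_fps \<rho> \<beta> $ n * z ^ n)"
    by (rule summable_fps) (simp add: wright_fps_conv_radius[OF assms])
  then have "wright \<rho> \<beta> (- z) = eval_fps (wright_fps \<rho> \<beta>) z / of_real (Gamma \<beta>)"
    unfolding wright_def eq eval_fps_def by (rule suminf_divide)
  then show ?thesis using nz by simp
qed

subsection \<open>Entire functions whose logarithmic derivative has coefficients of one sign\<close>

text \<open>The properties of \<open>wright_fps\<close> that determine the radii. \<open>A1\<close>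
  makes \<open>q 0\<close> positive, so that \<open>x * P x\<close> is at least a positive multiple
  of \<open>x\<close>.\<close>

locale positive_dlog =
  fixes A :: "complex fps"
  assumes conv: "fps_conv_radius A = \<infinity>"
    and A0: "A $ 0 = 1" and A1: "A $ 1 \<noteq> 0"
    and nonneg: "neg_dlog A $ k \<in> \<real>\<^sub>\<ge>\<^sub>0"
begin

definition L :: "complex \<Rightarrow> complex" where "L = eval_fps A"
definition Q :: "complex \<Rightarrow> complex" where "Q z = - deriv L z / L z"
definition q :: "nat \<Rightarrow> real" where "q k = Re (neg_dlog A $ k)"
text \<open>\<open>Re\<close> only changes the type: by \<open>Q_of_real\<close> the value of
  \<open>Q\<close> is already real for \<open>0 \<le> x < R\<close> if the disk of radius
  \<open>R\<close> is zero-free.\<close>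

definition P :: "real \<Rightarrow> real" where "P x = Re (Q (of_real x))"
definition zero_free :: "real \<Rightarrow> bool" where "zero_free R \<longleftrightarrow> (\<forall>z\<in>ball 0 R. L z \<noteq> 0)"

lemma L_holomorphic: "L holomorphic_on S"
  unfolding L_def by (rule holomorphic_on_eval_fps) (simp add: conv)

lemma L_0: "L 0 = 1"
  by (simp add: L_def eval_fps_at_0 A0)

lemma q_nonneg: "q k \<ge> 0" and q_eq: "neg_dlog A $ k = of_real (q k)"
  using nonneg[of k] by (auto simp: q_def complex_nonneg_Reals_iff complex_eq_iff)

lemma q_0: "q 0 > 0"
proof -
  have "neg_dlog A $ 0 = - A $ 1" by (subst neg_dlog_nth) (auto simp: A0)
  then have "q 0 \<noteq> 0" using A1 q_eq[of 0] by auto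
  then show ?thesis using q_nonneg[of 0] by simp
qed

lemma Q_holomorphic: "zero_free R \<Longrightarrow> Q holomorphic_on ball 0 R"
  unfolding Q_def zero_free_def
  by (intro holomorphic_intros holomorphic_deriv[OF L_holomorphic] L_holomorphic) auto

text \<open>\<open>Q\<close> is holomorphic on the zero-free disk, so its expansion at 0 converges
  on all of it.\<close>

lemma Q_sums:
  assumes "zero_free R" "norm z < R"
  shows "(\<lambda>n. of_real (q n) * z ^ n) sums Q z"
proof -
  have "L has_fps_expansion A"
    unfolding L_def by (rule eval_fps_has_fps_expansion) (simp add: conv)
  then have "(\<lambda>z. - deriv L z / L z) has_fps_expansion - fps_deriv A / A"
    by (intro fps_expansion_intros) (auto simp: A0)
  then have "Q has_fps_expansion neg_dlog A"
    by (simp add: neg_dlog_def Q_def[abs_def])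
  from has_fps_expansion_imp_sums_complex[OF this, of "ereal R" z] show ?thesis
    using Q_holomorphic[OF assms(1)] assms(2) by (simp add: q_eq)
qed

lemma Q_of_real:
  assumes "zero_free R" "0 \<le> x" "x < R"
  shows "Q (of_real x) = of_real (P x)" and "(\<lambda>n. q n * x ^ n) sums P x"
proof -
  have s: "(\<lambda>n. complex_of_real (q n * x ^ n)) sums Q (of_real x)"
    using Q_sums[OF assms(1), of "of_real x"] assms by simp
  from sums_Re[OF s] show "(\<lambda>n. q n * x ^ n) sums P x" by (simp add: P_def)
  from sums_of_real[OF this, where 'a = complex] s show "Q (of_real x) = of_real (P x)"
    using sums_unique2 by blast
qed

text \<open>Termwise triangle inequality; the coefficients are their own absolute values.\<close>

lemma norm_Q_le:
  assumes "zero_free R" "norm z < R"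
  shows "norm (Q z) \<le> P (norm z)"
proof (rule norm_sums_le)
  show "(\<lambda>n. of_real (q n) * z ^ n) sums Q z" by (rule Q_sums[OF assms])
  show "(\<lambda>n. q n * norm z ^ n) sums P (norm z)" by (rule Q_of_real[OF assms(1)]) (use assms in auto)
qed (simp add: norm_mult norm_power q_nonneg)

lemma P_mono:
  assumes "zero_free R" "0 \<le> x" "x \<le> y" "y < R"
  shows "P x \<le> P y"
proof (rule sums_le)
  show "(\<lambda>n. q n * x ^ n) sums P x" "(\<lambda>n. q n * y ^ n) sums P y"
    using assms by (auto intro!: Q_of_real[OF assms(1)])
qed (use assms in \<open>auto intro!: mult_left_mono power_mono q_nonneg\<close>)

lemma P_ge:
  assumes "zero_free R" "0 \<le> x" "x < R"
  shows "q 0 \<le> P x"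
proof -
  have "(\<lambda>n. q n * 0 ^ n) sums P 0" by (rule Q_of_real[OF assms(1)]) (use assms in auto)
  then have "P 0 = q 0" by (simp add: powser_sums_zero_iff)
  then show ?thesis using P_mono[OF assms(1), of 0 x] assms by simp
qed

section \<open>The point where \<open>c * (u * P u)\<close> reaches a prescribed value\<close>

lemma L_logarithm:
  assumes "R > 0" "zero_free R"
  obtains l where "l holomorphic_on ball 0 R" "l 0 = 0" "\<And>z. z \<in> ball 0 R \<Longrightarrow> exp (l z) = L z"
proof -
  obtain g where g: "g holomorphic_on ball 0 R" "\<And>z. z \<in> ball 0 R \<Longrightarrow> exp (g z) = L z"
    using holomorphic_logarithm_exists[of "ball 0 R" L 0] L_holomorphic assms
    by (auto simp: zero_free_def)
  show thesis
  \<comment> \<open>The shift is harmless since \<open>exp (g 0) = L 0 = 1\<close>.\<close>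
  proof (rule that[of "\<lambda>z. g z - g 0"])
    show "exp (g z - g 0) = L z" if "z \<in> ball 0 R" for z
      using g(2)[of z] g(2)[of 0] that assms by (simp add: exp_diff L_0)
  qed (auto intro!: holomorphic_intros g)
qed

lemma logarithm_deriv:
  assumes l: "l holomorphic_on ball 0 R" "\<And>z. z \<in> ball 0 R \<Longrightarrow> exp (l z) = L z"
    and z: "z \<in> ball 0 R"
  shows "(l has_field_derivative - Q z) (at z)"
proof -
  have d: "(l has_field_derivative deriv l z) (at z)"
    using l z by (intro holomorphic_derivI[of l "ball 0 R"]) auto
  then have "((\<lambda>z. exp (l z)) has_field_derivative exp (l z) * deriv l z) (at z)"
    by (auto intro!: derivative_eq_intros)
  then have "(L has_field_derivative exp (l z) * deriv l z) (at z)"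
    by (rule has_field_derivative_transform_within_open[of _ _ _ "ball 0 R"]) (use l z in auto)
  then have "deriv L z = L z * deriv l z" using l(2)[OF z] by (simp add: DERIV_imp_deriv)
  moreover have "L z \<noteq> 0" using l(2)[OF z] by (metis exp_not_eq_zero)
  ultimately show ?thesis using d by (simp add: Q_def)
qed

text \<open>If \<open>v P v\<close> stayed bounded up to the first zero of \<open>L\<close>, then so would a logarithm of \<open>L\<close>.\<close>
lemma exists_large:
  assumes "c > 0" "\<alpha> > 0"
  shows "\<exists>R v. 0 < v \<and> v < R \<and> zero_free R \<and> \<alpha> \<le> c * (v * P v)"
proof (cases "\<forall>z. L z \<noteq> 0")
  case True
  \<comment> \<open>Without zeros the bound \<open>q 0 \<le> P v\<close> is enough, and this
    \<open>v\<close> solves \<open>c * (v * q 0) = \<alpha>\<close>.\<close>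
  define v where "v = \<alpha> / (c * q 0)"
  have v: "v > 0" using assms q_0 by (simp add: v_def)
  have zf: "zero_free (v + 1)" using True by (simp add: zero_free_def)
  have "\<alpha> = c * (v * q 0)" using assms q_0 by (simp add: v_def)
  also have "\<dots> \<le> c * (v * P v)"
    using assms v P_ge[OF zf, of v] by (intro mult_left_mono) auto
  finally show ?thesis using v zf by (intro exI[of _ "v + 1"] exI[of _ v]) auto
next
  case False
  have "closed {z. L z = 0}"
    using holomorphic_on_imp_continuous_on[OF L_holomorphic[of UNIV]]
    by (intro closed_Collect_eq) auto
  \<comment> \<open>A zero of least modulus, so that the open disk reaching up to it is
    zero-free.\<close>
  then obtain w where w: "L w = 0" "\<And>z. L z = 0 \<Longrightarrow> norm w \<le> norm z"
    using False distance_attains_inf[of "{z. L z = 0}" 0] by auto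
  define R where "R = norm w"
  have "w \<noteq> 0" using w L_0 by auto
  then have R: "R > 0" by (simp add: R_def)
  have zf: "zero_free R" unfolding zero_free_def R_def using w(2) by force
  have "\<exists>v. 0 < v \<and> v < R \<and> \<alpha> \<le> c * (v * P v)"
  proof (rule ccontr)
    assume "\<not> ?thesis"
    then have small: "c * (v * P v) < \<alpha>" if "0 < v" "v < R" for v using that by force
    define B where "B = 2 * \<alpha> / (c * R)"
    have QB: "norm (Q z) \<le> B" if "z \<in> ball 0 R" for z
    proof -
      \<comment> \<open>Staying above \<open>R / 2\<close> permits division by \<open>v\<close> in
        the bound on \<open>v * P v\<close>; monotonicity of \<open>P\<close> carries the result
        back to \<open>norm z\<close>.\<close>
      define v where "v = max (norm z) (R / 2)"
      have v: "R / 2 \<le> v" "norm z \<le> v" "v < R" "0 < v" using that R by (auto simp: v_def)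
      have "0 \<le> P v" using P_ge[OF zf, of v] v q_0 by simp
      have "c * (R / 2 * P v) \<le> c * (v * P v)"
        using v assms \<open>0 \<le> P v\<close> by (intro mult_left_mono mult_right_mono) auto
      also have "\<dots> < \<alpha>" using small v by simp
      finally have "P v \<le> B" using assms R by (simp add: B_def field_simps)
      moreover have "norm (Q z) \<le> P (norm z)" using that by (intro norm_Q_le[OF zf]) auto
      moreover have "P (norm z) \<le> P v" using v by (intro P_mono[OF zf]) auto
      ultimately show ?thesis by simp
    qed
    obtain l where l: "l holomorphic_on ball 0 R" "l 0 = 0" "\<And>z. z \<in> ball 0 R \<Longrightarrow> exp (l z) = L z"
      using L_logarithm[OF R zf] by metis
    have "B \<ge> 0" using assms R by (simp add: B_def)
    \<comment> \<open>A bounded derivative bounds the logarithm, which keeps \<open>L\<close> away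
      from 0 on the disk and, by continuity, at its boundary point \<open>w\<close>.\<close>
    have "exp (- (B * R)) \<le> norm (L z)" if z: "z \<in> ball 0 R" for z
    proof -
      have "norm (l z - l 0) \<le> B * norm (z - 0)"
      proof (rule field_differentiable_bound[of "ball 0 R" l "\<lambda>z. - Q z"])
        show "(l has_field_derivative - Q x) (at x within ball 0 R)" if "x \<in> ball 0 R" for x
          using logarithm_deriv[OF l(1,3) that] by (rule has_field_derivative_at_within)
      qed (use QB R z in auto)
      also have "\<dots> \<le> B * R" using z \<open>B \<ge> 0\<close> by (intro mult_left_mono) auto
      finally have "norm (l z) \<le> B * R" by (simp add: l)
      then have "- (B * R) \<le> Re (l z)" using abs_Re_le_cmod[of "l z"] by linarith
      then show ?thesis by (simp flip: l(3)[OF z])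
    qed
    then have "ball 0 R \<subseteq> {z. exp (- (B * R)) \<le> norm (L z)}" by auto
    moreover have "closed {z. exp (- (B * R)) \<le> norm (L z)}"
      using holomorphic_on_imp_continuous_on[OF L_holomorphic[of UNIV]]
      by (intro closed_Collect_le continuous_intros) auto
    ultimately have "closure (ball 0 R) \<subseteq> {z. exp (- (B * R)) \<le> norm (L z)}"
      by (rule closure_minimal)
    moreover have "w \<in> closure (ball 0 R)" using R by (simp add: R_def)
    ultimately have "exp (- (B * R)) \<le> norm (L w)" by blast
    then show False using w by simp
  qed
  then show ?thesis using zf by blast
qed

text \<open>Intermediate value theorem between 0 and the point from
  \<open>exists_large\<close>.\<close>

lemma exists_crossing:
  assumes "c > 0" "\<alpha> > 0"
  shows "\<exists>R u. 0 < u \<and> u < R \<and> zero_free R \<and> c * (u * P u) = \<alpha>"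
proof -
  obtain R v where v: "0 < v" "v < R" "zero_free R" "\<alpha> \<le> c * (v * P v)"
    using exists_large[OF assms] by blast
  have "continuous_on {0..v} (\<lambda>x. Q (of_real x))"
    using v by (intro continuous_on_compose2[OF holomorphic_on_imp_continuous_on[OF Q_holomorphic[OF v(3)]]]
      continuous_intros) auto
  then have "continuous_on {0..v} (\<lambda>x. c * (x * P x))"
    unfolding P_def by (intro continuous_intros)
  with v obtain u where u: "0 \<le> u" "u \<le> v" "c * (u * P u) = \<alpha>"
    using IVT'[of "\<lambda>x. c * (x * P x)" 0 \<alpha> v] assms by auto
  moreover have "u \<noteq> 0" using u assms by auto
  ultimately show ?thesis using v by (intro exI[of _ R] exI[of _ u]) auto
qed

text \<open>\<open>f\<close> has the germ of \<open>z L(z\<^sup>j)\<^sup>\<kappa>\<close> at \<open>0\<close>, for the branch of the power with value \<open>1\<close> there.\<close>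
definition power_branch :: "real \<Rightarrow> nat \<Rightarrow> (complex \<Rightarrow> complex) \<Rightarrow> bool" where
  "power_branch \<kappa> j f \<longleftrightarrow> (\<forall>R l. R > 0 \<longrightarrow> l holomorphic_on ball 0 R \<longrightarrow> l 0 = 0 \<longrightarrow>
    (\<forall>z\<in>ball 0 R. exp (l z) = L z) \<longrightarrow>
    (\<forall>\<^sub>F z in nhds 0. f z = z * exp (of_real \<kappa> * l (z ^ j))))"

section \<open>Starlikeness radii of the power branches\<close>

lemma power_in_ball: "(z::complex) \<in> ball 0 s \<Longrightarrow> j > 0 \<Longrightarrow> z ^ j \<in> ball 0 (s ^ j)"
  by (simp add: norm_power power_strict_mono)

lemma tendsto_power_nhds_0:
  assumes "j > 0"
  shows "((\<lambda>z::complex. z ^ j) \<longlongrightarrow> 0) (nhds 0)"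
proof -
  have "((\<lambda>z::complex. z ^ j) \<longlongrightarrow> 0 ^ j) (nhds 0)" by (intro tendsto_power filterlim_ident)
  then show ?thesis unfolding zero_power[OF assms] .
qed

text \<open>The radius is chosen before the target \<open>\<phi>\<close>, so two targets share it.
  For \<open>norm z < r\<close> the quotient lies in \<open>ball 1 \<alpha>\<close>, and at
  \<open>z = r\<close> it equals the omitted value \<open>1 - \<alpha>\<close>.\<close>

lemma starlike_radius_exists:
  assumes \<kappa>: "\<kappa> > 0" and j: "j > 0" and f: "power_branch \<kappa> j f" and \<alpha>: "\<alpha> > 0"
  shows "\<exists>r. \<forall>\<phi>. ball 1 \<alpha> \<subseteq> \<phi> ` ball 0 1 \<longrightarrow> of_real (1 - \<alpha>) \<notin> \<phi> ` ball 0 1 \<longrightarrow>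
    is_starlike_radius \<phi> f r"
proof -
  define c where "c = \<kappa> * real j"
  have c: "c > 0" using \<kappa> j by (simp add: c_def)
  obtain R u where u: "0 < u" "u < R" "zero_free R" "c * (u * P u) = \<alpha>"
    using exists_crossing[OF c \<alpha>] by blast
  obtain l where l: "l holomorphic_on ball 0 R" "l 0 = 0" "\<And>z. z \<in> ball 0 R \<Longrightarrow> exp (l z) = L z"
    using L_logarithm[of R] u by (metis less_trans)
  \<comment> \<open>The crossing point \<open>u\<close> and the bound \<open>R\<close> refer to the
    variable \<open>z ^ j\<close>; the roots return to \<open>z\<close>.\<close>
  define r R' where "r = root j u" and "R' = root j R"
  have r: "0 < r" "r < R'" "r ^ j = u" "R' ^ j = R"
    using u j by (auto simp: r_def R'_def real_root_pow_pos2)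
  define F where "F z = z * exp (of_real \<kappa> * l (z ^ j))" for z
  have dF: "(F has_field_derivative
      exp (of_real \<kappa> * l (z ^ j)) * (1 - of_real c * (z ^ j * Q (z ^ j)))) (at z)"
    if z: "z \<in> ball 0 R'" for z
  proof -
    have zj: "z ^ j \<in> ball 0 R" using power_in_ball[OF z j] r by simp
    have "((\<lambda>z. l (z ^ j)) has_field_derivative - Q (z ^ j) * (of_nat j * z ^ (j - 1))) (at z)"
      by (rule DERIV_chain2[where f = l], rule logarithm_deriv[OF l(1) l(3) zj]) (auto intro!: derivative_eq_intros)
    then have "(F has_field_derivative exp (of_real \<kappa> * l (z ^ j)) +
        z * (exp (of_real \<kappa> * l (z ^ j)) * (of_real \<kappa> * (- Q (z ^ j) * (of_nat j * z ^ (j - 1)))))) (at z)"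
      unfolding F_def by (auto intro!: derivative_eq_intros)
    moreover have "E + z * (E * (of_real \<kappa> * (- q * (of_nat j * w)))) = E * (1 - of_real c * ((z * w) * q))"
      for E q w by (simp add: c_def algebra_simps)
    moreover have "z * z ^ (j - 1) = z ^ j" using j by (simp add: power_eq_if)
    ultimately show ?thesis by metis
  qed
  have F_holo: "F holomorphic_on ball 0 R'"
    unfolding holomorphic_on_open[OF open_ball] by (intro ballI exI) (rule dF)
  have quot: "z * deriv F z / F z = 1 - of_real c * (z ^ j * Q (z ^ j))"
    if "z \<in> ball 0 R'" "z \<noteq> 0" for z
    using that(2) by (simp add: DERIV_imp_deriv[OF dF[OF that(1)]] F_def)
  have F_nz: "F z \<noteq> 0" if "z \<noteq> 0" for z using that by (simp add: F_def)
  have ev: "\<forall>\<^sub>F z in nhds 0. F z = f z"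
  proof -
    have "R > 0" using u by simp
    then have "\<forall>\<^sub>F z in nhds 0. f z = z * exp (of_real \<kappa> * l (z ^ j))"
      using f l unfolding power_branch_def by blast
    then show ?thesis by eventually_elim (simp add: F_def)
  qed
  have inside: "dist 1 (z * deriv F z / F z) < \<alpha>" if z: "z \<in> ball 0 r" "z \<noteq> 0" for z
  proof -
    have zj: "norm (z ^ j) < u" using power_in_ball[OF z(1) j] r by simp
    have "norm (z ^ j) * norm (Q (z ^ j)) \<le> norm (z ^ j) * P u"
      using norm_Q_le[OF u(3), of "z ^ j"] P_mono[OF u(3), of "norm (z ^ j)" u] zj u
      by (intro mult_left_mono) auto
    \<comment> \<open>Strictness comes from \<open>norm (z ^ j) < u\<close> together with
      \<open>P u \<ge> q 0 > 0\<close>.\<close>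
    also have "\<dots> < u * P u"
      using zj P_ge[OF u(3), of u] u q_0 by (intro mult_strict_right_mono) auto
    finally have "c * (norm (z ^ j) * norm (Q (z ^ j))) < \<alpha>"
      using c u(4) by (metis mult_less_cancel_left_pos)
    then show ?thesis using z r c by (simp add: quot dist_norm norm_mult)
  qed
  have at_r: "of_real r * deriv F (of_real r) / F (of_real r) = of_real (1 - \<alpha>)"
  proof -
    have "complex_of_real r ^ j = of_real u" using r by (simp flip: of_real_power)
    then have "of_real r * deriv F (of_real r) / F (of_real r) = 1 - of_real c * (of_real u * Q (of_real u))"
      using r by (subst quot) auto
    also have "\<dots> = of_real (1 - c * (u * P u))"
      using u(1,2) by (simp add: Q_of_real(1)[OF u(3)])
    finally show ?thesis by (simp only: u(4))
  qed
  show ?thesis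
  proof (intro exI[of _ r] allI impI)
    fix \<phi> :: "complex \<Rightarrow> complex"
    assume \<phi>: "ball 1 \<alpha> \<subseteq> \<phi> ` ball 0 1" "of_real (1 - \<alpha>) \<notin> \<phi> ` ball 0 1"
    have "starlike_on_disk \<phi> F r"
      unfolding starlike_on_disk_def
    proof (intro conjI ballI)
      show "F holomorphic_on ball 0 r" using F_holo r by (auto elim: holomorphic_on_subset)
      show "F 0 = 0" by (simp add: F_def)
      show "deriv F 0 = 1" using DERIV_imp_deriv[OF dF[of 0]] r(1,2) l(2) by (simp add: zero_power[OF j])
    next
      fix z :: complex assume "z \<in> ball 0 r - {0}"
      then show "F z \<noteq> 0" "z * deriv F z / F z \<in> \<phi> ` ball 0 1"
        using F_nz inside[of z] \<phi>(1) by auto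
    qed
    then have "in_starlike_class \<phi> f r" using ev by (auto simp: in_starlike_class_def)
    moreover have "s \<le> r" if s: "s > 0" "in_starlike_class \<phi> f s" for s
    proof (rule ccontr)
      assume "\<not> s \<le> r"
      from s(2) obtain G where G: "\<forall>\<^sub>F z in nhds 0. G z = f z" "starlike_on_disk \<phi> G s"
        by (auto simp: in_starlike_class_def)
      \<comment> \<open>Both \<open>G\<close> and \<open>F\<close> are holomorphic on this disk,
        which still contains the point \<open>r\<close>. The identity theorem then transfers the
        omitted value to \<open>G\<close>.\<close>
      define t where "t = min s R'"
      have t: "r < t" "t \<le> s" "t \<le> R'" using \<open>\<not> s \<le> r\<close> r by (auto simp: t_def)
      have "\<forall>\<^sub>F z in nhds 0. G z = F z" using G(1) ev by eventually_elim simp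
      then obtain S where S: "open S" "0 \<in> S" "\<And>z. z \<in> S \<Longrightarrow> G z = F z"
        by (auto simp: eventually_nhds)
      have GF: "G z = F z" if "z \<in> ball 0 t" for z
      proof (rule analytic_continuation_open[of "S \<inter> ball 0 t" "ball 0 t" G F z])
        show "S \<inter> ball 0 t \<noteq> {}" using S r t by force
        show "G holomorphic_on ball 0 t" using G(2) t
          by (auto simp: starlike_on_disk_def elim!: holomorphic_on_subset)
        show "F holomorphic_on ball 0 t" using F_holo t by (auto elim!: holomorphic_on_subset)
      qed (use S that in auto)
      have rt: "complex_of_real r \<in> ball 0 t" using r t by simp
      then have "\<forall>\<^sub>F z in nhds (complex_of_real r). z \<in> ball 0 t"
        by (intro eventually_nhds_in_open) auto
      then have "\<forall>\<^sub>F z in nhds (complex_of_real r). G z = F z" by eventually_elim (rule GF)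
      then have "deriv G (of_real r) = deriv F (of_real r)" by (intro deriv_cong_ev) auto
      moreover have "of_real r * deriv G (of_real r) / G (of_real r) \<in> \<phi> ` ball 0 1"
        using G(2) r t by (auto simp: starlike_on_disk_def)
      ultimately show False using at_r \<phi>(2) GF[OF rt] by simp
    qed
    ultimately show "is_starlike_radius \<phi> f r" using r by (auto simp: is_starlike_radius_def)
  qed
qed

lemma power_branch_times_L:
  assumes "j > 0" "\<And>z. f z = z * L (z ^ j)"
  shows "power_branch 1 j f"
  unfolding power_branch_def
proof (intro allI impI)
  fix R l assume R: "(R::real) > 0" and l: "\<forall>z\<in>ball 0 R. exp (l z) = L z"
  have "\<forall>\<^sub>F z::complex in nhds 0. z ^ j \<in> ball 0 R"
    using topological_tendstoD[OF tendsto_power_nhds_0[OF assms(1)] open_ball[of 0 R]] R by simp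
  then show "\<forall>\<^sub>F z in nhds 0. f z = z * exp (of_real 1 * l (z ^ j))"
    by eventually_elim (use l assms(2) in auto)
qed

text \<open>Near 0 the logarithm \<open>l (z ^ j)\<close> has imaginary part between
  \<open>-pi\<close> and \<open>pi\<close>, so it agrees with the principal logarithm in
  \<open>powr\<close>.\<close>

lemma power_branch_times_L_powr:
  assumes "j > 0" "\<And>z. f z = z * L (z ^ j) powr of_real \<kappa>"
  shows "power_branch \<kappa> j f"
  unfolding power_branch_def
proof (intro allI impI)
  fix R l
  assume R: "(R::real) > 0" and l: "\<forall>z\<in>ball 0 R. exp (l z) = L z"
    and holo: "l holomorphic_on ball 0 R" and l0: "l 0 = 0"
  have pw: "((\<lambda>z::complex. z ^ j) \<longlongrightarrow> 0) (nhds 0)"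
    by (intro tendsto_power_nhds_0 assms)
  have "isCont l 0"
    using holomorphic_on_imp_continuous_on[OF holo] R by (simp add: continuous_on_eq_continuous_at)
  then have "(l \<longlongrightarrow> 0) (nhds 0)" unfolding isCont_def l0 tendsto_at_iff_tendsto_nhds[of l 0, unfolded l0] .
  then have "((\<lambda>z. Im (l (z ^ j))) \<longlongrightarrow> Im 0) (nhds 0)"
    by (intro tendsto_Im filterlim_compose[OF _ pw])
  then have "\<forall>\<^sub>F z in nhds 0. Im (l (z ^ j)) \<in> {-pi<..<pi}"
    by (intro topological_tendstoD) auto
  moreover have "\<forall>\<^sub>F z::complex in nhds 0. z ^ j \<in> ball 0 R"
    using topological_tendstoD[OF pw open_ball[of 0 R]] R by simp
  ultimately show "\<forall>\<^sub>F z in nhds 0. f z = z * exp (of_real \<kappa> * l (z ^ j))"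
  proof eventually_elim
    case (elim z)
    have "L (z ^ j) = exp (l (z ^ j))" using l elim by simp
    moreover have "Ln (exp (l (z ^ j))) = l (z ^ j)" using elim by (intro Ln_exp) auto
    ultimately show ?case by (simp add: assms(2) powr_def)
  qed
qed

end

subsection \<open>Ma-Minda functions\<close>

text \<open>If \<open>b\<close> were a value, continuity at \<open>b\<close> of the inverse
  \<open>g\<close> would give \<open>g b = -1\<close>, a point outside the open disk.\<close>

lemma ma_minda_left_limit_notin:
  assumes "ma_minda \<phi>" and lim: "((\<lambda>x::real. \<phi> (of_real x)) \<longlongrightarrow> b) (at_right (-1))"
  shows "b \<notin> \<phi> ` ball 0 1"
proof
  assume "b \<in> \<phi> ` ball 0 1"
  then obtain w where w: "w \<in> ball 0 1" "b = \<phi> w" by blast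
  have \<phi>: "\<phi> holomorphic_on ball 0 1" "inj_on \<phi> (ball 0 1)"
    using assms(1) by (auto simp: ma_minda_def)
  obtain g where g: "g holomorphic_on \<phi> ` ball 0 1" "\<And>z. z \<in> ball 0 1 \<Longrightarrow> g (\<phi> z) = z"
    using holomorphic_has_inverse[OF \<phi>(1) _ \<phi>(2)] by (metis open_ball)
  have "open (\<phi> ` ball 0 1)" using open_mapping_thm3[OF \<phi>(1) _ \<phi>(2)] by simp
  then have "isCont g b"
    using holomorphic_on_imp_continuous_on[OF g(1)] w by (auto simp: continuous_on_eq_continuous_at)
  then have "((\<lambda>x::real. g (\<phi> (of_real x))) \<longlongrightarrow> g b) (at_right (-1))"
    using lim by (rule isCont_tendsto_compose)
  moreover have "\<forall>\<^sub>F x in at_right (-1::real). g (\<phi> (of_real x)) = of_real x"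
    using eventually_at_right_real[of "-1" "1::real"]
    by (auto elim!: eventually_mono intro!: g(2) simp: abs_less_iff)
  ultimately have "((\<lambda>x::real. complex_of_real x) \<longlongrightarrow> g b) (at_right (-1))"
    by (rule Lim_transform_eventually)
  moreover have "((\<lambda>x::real. complex_of_real x) \<longlongrightarrow> of_real (-1)) (at_right (-1))"
    by (intro tendsto_intros)
  ultimately have "g b = of_real (-1)"
    using tendsto_unique trivial_limit_at_right_real by blast
  then have "w = - 1" using w g(2) by simp
  then show False using w by simp
qed

text \<open>The supremum of the admissible radii is attained since an open ball is the union of its
  smaller concentric balls. It is at most 1 because \<open>Re (\<phi> z) > 0\<close> excludes the
  value 0.\<close>

lemma ma_minda_largest_disk:
  assumes "ma_minda \<phi>"
  obtains \<alpha> :: real where "0 < \<alpha>" "\<alpha> \<le> 1" "ball 1 \<alpha> \<subseteq> \<phi> ` ball 0 1"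
    "\<And>s. ball 1 s \<subseteq> \<phi> ` ball 0 1 \<Longrightarrow> s \<le> \<alpha>"
proof -
  have \<phi>: "\<phi> holomorphic_on ball 0 1" "inj_on \<phi> (ball 0 1)" "\<phi> 0 = 1"
    "\<And>z. z \<in> ball 0 1 \<Longrightarrow> Re (\<phi> z) > 0"
    using assms by (auto simp: ma_minda_def)
  define D where "D = {s::real. ball 1 s \<subseteq> \<phi> ` ball 0 1}"
  have "open (\<phi> ` ball 0 1)" using open_mapping_thm3[OF \<phi>(1) _ \<phi>(2)] by simp
  moreover have "1 \<in> \<phi> ` ball 0 1" using \<phi>(3) by (metis centre_in_ball imageI zero_less_one)
  ultimately obtain e where e: "e > 0" "e \<in> D" by (auto simp: D_def open_contains_ball)
  have le: "s \<le> 1" if "s \<in> D" for s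
  proof (rule ccontr)
    assume "\<not> s \<le> 1"
    then have "0 \<in> \<phi> ` ball 0 1" using that by (auto simp: D_def)
    then show False using \<phi>(4) by force
  qed
  then have bdd: "bdd_above D" by (auto simp: bdd_above_def)
  show thesis
  proof
    show "0 < Sup D" using e cSup_upper[OF e(2) bdd] by linarith
    show "Sup D \<le> 1" using e le by (intro cSup_least) auto
    show "s \<le> Sup D" if "ball 1 s \<subseteq> \<phi> ` ball 0 1" for s
      using that by (intro cSup_upper bdd) (simp add: D_def)
    show "ball 1 (Sup D) \<subseteq> \<phi> ` ball 0 1"
    proof
      fix w :: complex assume "w \<in> ball 1 (Sup D)"
      then have "dist 1 w < Sup D" by simp
      then obtain s where "s \<in> D" "dist 1 w < s" using less_cSupD[of D] e by blast
      then show "w \<in> \<phi> ` ball 0 1" by (auto simp: D_def)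
    qed
  qed
qed

lemma affine_disk_image:
  assumes "\<alpha> > 0"
  shows "(\<lambda>z. 1 + complex_of_real \<alpha> * z) ` ball 0 1 = ball 1 \<alpha>"
proof (intro equalityI subsetI)
  fix w :: complex assume "w \<in> ball 1 \<alpha>"
  then have "(w - 1) / of_real \<alpha> \<in> ball 0 1"
    using assms by (simp add: norm_divide dist_norm norm_minus_commute)
  moreover have "w = 1 + of_real \<alpha> * ((w - 1) / of_real \<alpha>)" using assms by simp
  ultimately show "w \<in> (\<lambda>z. 1 + of_real \<alpha> * z) ` ball 0 1" by blast
qed (use assms in \<open>auto simp: dist_norm norm_mult\<close>)

theorem theorem2p2:
  fixes \<rho> \<beta> :: real and \<phi> :: "complex \<Rightarrow> complex"
  assumes "\<rho> > 0" and "\<beta> > 0" and "ma_minda \<phi>"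
  shows "\<exists>\<alpha>::real. 0 < \<alpha> \<and> \<alpha> \<le> 1 \<and>
    ball 1 \<alpha> \<subseteq> \<phi> ` ball 0 1 \<and>
    (\<forall>s. ball 1 s \<subseteq> \<phi> ` ball 0 1 \<longrightarrow> s \<le> \<alpha>) \<and>
    (((\<lambda>x::real. \<phi> (of_real x)) \<longlongrightarrow> of_real (1 - \<alpha>)) (at_right (-1)) \<longrightarrow>
      (\<forall>f \<in> {wright_f \<rho> \<beta>, wright_g \<rho> \<beta>, wright_h \<rho> \<beta>}.
        \<exists>r. is_starlike_radius \<phi> f r \<and>
            is_starlike_radius (\<lambda>z. 1 + of_real \<alpha> * z) f r))"
proof -
  obtain \<alpha> where \<alpha>: "0 < \<alpha>" "\<alpha> \<le> 1" "ball 1 \<alpha> \<subseteq> \<phi> ` ball 0 1"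
    "\<And>s. ball 1 s \<subseteq> \<phi> ` ball 0 1 \<Longrightarrow> s \<le> \<alpha>"
    using ma_minda_largest_disk[OF assms(3)] by metis
  interpret positive_dlog "wright_fps \<rho> \<beta>"
  proof
    have "Gamma \<beta> > 0" "Gamma (\<rho> + \<beta>) > 0" using assms by (auto intro!: Gamma_real_pos)
    then show "wright_fps \<rho> \<beta> $ 1 \<noteq> 0" by (simp add: wright_fps_def)
  qed (use assms in \<open>auto simp: wright_fps_conv_radius wright_fps_nth_0 neg_dlog_wright_nonneg\<close>)
  have L: "L z = of_real (Gamma \<beta>) * wright \<rho> \<beta> (- z)" for z
    unfolding L_def by (rule eval_wright_fps[OF assms(1,2)])
  have radius: "\<exists>r. is_starlike_radius \<phi> f r \<and> is_starlike_radius (\<lambda>z. 1 + of_real \<alpha> * z) f r"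
    if lim: "((\<lambda>x::real. \<phi> (of_real x)) \<longlongrightarrow> of_real (1 - \<alpha>)) (at_right (-1))"
      and f: "f \<in> {wright_f \<rho> \<beta>, wright_g \<rho> \<beta>, wright_h \<rho> \<beta>}" for f
  proof -
    have "power_branch (1 / \<beta>) 2 (wright_f \<rho> \<beta>)"
      by (rule power_branch_times_L_powr) (auto simp: wright_f_def L)
    moreover have "power_branch 1 2 (wright_g \<rho> \<beta>)"
      by (rule power_branch_times_L) (auto simp: wright_g_def L)
    moreover have "power_branch 1 1 (wright_h \<rho> \<beta>)"
      by (rule power_branch_times_L) (auto simp: wright_h_def L)
    moreover have "1 / \<beta> > 0" using assms(2) by simp
    \<comment> \<open>The pairs \<open>(\<kappa>, j)\<close> are \<open>(1 / \<beta>, 2)\<close>,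
      \<open>(1, 2)\<close> and \<open>(1, 1)\<close> for \<open>wright_f\<close>,
      \<open>wright_g\<close> and \<open>wright_h\<close>.\<close>
    ultimately obtain \<kappa> j where kj: "\<kappa> > 0" "j > 0" "power_branch \<kappa> j f"
      using f by (metis empty_iff insert_iff zero_less_numeral zero_less_one)
    obtain r where r: "\<And>\<psi>. ball 1 \<alpha> \<subseteq> \<psi> ` ball 0 1 \<Longrightarrow> of_real (1 - \<alpha>) \<notin> \<psi> ` ball 0 1 \<Longrightarrow>
        is_starlike_radius \<psi> f r"
      using starlike_radius_exists[OF kj \<alpha>(1)] by metis
    have "is_starlike_radius \<phi> f r"
      using \<alpha>(3) ma_minda_left_limit_notin[OF assms(3) lim] by (rule r)
    \<comment> \<open>The image is exactly \<open>ball 1 \<alpha>\<close>, which omits its boundary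
      point \<open>1 - \<alpha>\<close>.\<close>
    moreover have "is_starlike_radius (\<lambda>z. 1 + of_real \<alpha> * z) f r"
      using \<alpha>(1) by (intro r) (auto simp: affine_disk_image dist_norm)
    ultimately show ?thesis by blast
  qed
  show ?thesis using \<alpha> radius by blast
qed

end
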